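(* Fix a partial Steiner triple system on a point set $V$ of cardinality $n$. Suppose that the triple system has $k$ pairwise disjoint blocks, but does not have $k+1$ pairwise disjoint blocks. Then the triple system is sequenceable provided that $$n>9k+22k^{2/3}+10.$$
   Context: A partial Steiner triple system on a finite point set $V$ is a set of $3$-subsets of $V$, called blocks, any two distinct ones of which intersect in at most one element. A sequencing of $V$ (with $|V|=n$) is a sequence $x_1,\ldots,x_n$ in which every element of $V$ occurs exactly once. A segment is a subsequence of consecutive entries. A partial Steiner triple system is sequenceable if there exists a sequencing of its point set such that for all $r\geq 1$, no segment of length $3r$ has its set of entries equal to the union of $r$ pairwise disjoint blocks. *)

theory Defs
  imports Complex_Main "HOL-Library.Sublist"
begin

definition partial_steiner_triple_system :: "'a set \<Rightarrow> 'a set set \<Rightarrow> bool" where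
  "partial_steiner_triple_system V \<B> \<longleftrightarrow>
     finite V \<and>
     (\<forall>b\<in>\<B>. b \<subseteq> V \<and> card b = 3) \<and>
     (\<forall>b\<in>\<B>. \<forall>c\<in>\<B>. b \<noteq> c \<longrightarrow> card (b \<inter> c) \<le> 1)"

definition disjoint_blocks :: "'a set set \<Rightarrow> nat \<Rightarrow> 'a set set \<Rightarrow> bool" where
  "disjoint_blocks \<B> r D \<longleftrightarrow> D \<subseteq> \<B> \<and> card D = r \<and> pairwise disjnt D"

definition sequencing :: "'a set \<Rightarrow> 'a list \<Rightarrow> bool" where
  "sequencing V xs \<longleftrightarrow> distinct xs \<and> set xs = V"

(* sublist is the relation of being a contiguous sublist; subsequences are called subseq. *)
definition sequenceable :: "'a set \<Rightarrow> 'a set set \<Rightarrow> bool" where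
  "sequenceable V \<B> \<longleftrightarrow>
     (\<exists>xs. sequencing V xs \<and>
       (\<forall>r\<ge>1. \<not> (\<exists>s D. sublist s xs \<and> length s = 3 * r \<and>
                        disjoint_blocks \<B> r D \<and> set s = \<Union>D)))"

end

theory Submission
  imports Defs "HOL-Library.Multiset"
begin

text \<open>
  Let \<open>W\<close> be the set of the \<open>3k\<close> points covered by a maximum family of disjoint blocks. By
  maximality every block meets \<open>W\<close>, so a union of \<open>r\<close> disjoint blocks has at least \<open>r\<close> of its
  \<open>3r\<close> points in \<open>W\<close>. Give a point of \<open>W\<close> the weight \<open>-2\<close> and every other point the weight \<open>1\<close>:
  a segment that is such a union has weight at most \<open>0\<close>. A sequencing in which the points of \<open>W\<close>
  are spread out therefore has few dangerous segments.

  With \<open>u\<close> standing for points outside \<open>W\<close> and \<open>w\<close> for points of \<open>W\<close>, the sequencing is a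
  concatenation of chunks of shape \<open>u u w  u u w  ...  u u w  u u u\<close>, each with at most \<open>m\<close>
  points of \<open>W\<close>. Prefixes of a chunk have weight at least \<open>0\<close> and, thanks to the three extra
  points, nonempty suffixes have positive weight. So a segment that meets two chunks has positive
  weight, and only segments inside one chunk are dangerous (lemma
  \<open>nonpositive_segment_within_chunk\<close>). There every segment has weight at least \<open>-2\<close>, so in a
  dangerous segment some block has exactly one point in \<open>W\<close>. It remains to choose the points
  outside \<open>W\<close> so that no chunk contains a block of that kind. This is done greedily (lemma
  \<open>greedy_independent_set\<close>): two points lie in at most one common block, so at any moment the
  choices already made in a chunk exclude at most \<open>m (2m + 2)\<close> points. The greedy choice succeeds
  if some \<open>2 (m + 1)\<^sup>2\<close> points outside \<open>W\<close> are held in reserve; they are appended at the end.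

  With \<open>q\<close> chunks, where \<open>m q \<ge> 3k\<close>, the construction needs more than
  \<open>6k + 3q + 2 (m + 1)\<^sup>2\<close> points outside \<open>W\<close>. Balancing the last two terms leads to
  \<open>m\<close> of order \<open>k\<^sup>1\<^sup>/\<^sup>3\<close> and \<open>q\<close> of order \<open>k\<^sup>2\<^sup>/\<^sup>3\<close>, which is the origin of the exponent \<open>2/3\<close>.
\<close>

section \<open>Weights of segments\<close>

definition weight :: "'a set \<Rightarrow> 'a list \<Rightarrow> int" where
  "weight W xs = (\<Sum>x\<leftarrow>xs. if x \<in> W then - 2 else 1)"

lemma weight_simps [simp]:
  "weight W [] = 0"
  "weight W (x # xs) = (if x \<in> W then - 2 else 1) + weight W xs"
  "weight W (xs @ ys) = weight W xs + weight W ys"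
  by (simp_all add: weight_def)

lemma weight_distinct:
  assumes "distinct xs"
  shows "weight W xs = int (length xs) - 3 * int (card (set xs \<inter> W))"
  using assms by (induction xs) (auto simp: Int_insert_left)

lemma weight_disjoint:
  assumes "set xs \<inter> W = {}"
  shows "weight W xs = int (length xs)"
  using assms by (induction xs) auto

text \<open>
  The prefix and suffix conditions make weights positive across the boundary of two chunks; the
  condition on segments limits how many points of \<open>W\<close> a segment inside a chunk can have.
\<close>

definition balanced :: "'a set \<Rightarrow> 'a list \<Rightarrow> bool" where
  "balanced W c \<longleftrightarrow>
     (\<forall>p. prefix p c \<longrightarrow> 0 \<le> weight W p) \<and>
     (\<forall>s. suffix s c \<longrightarrow> s \<noteq> [] \<longrightarrow> 0 < weight W s) \<and>
     (\<forall>s. sublist s c \<longrightarrow> - 2 \<le> weight W s)"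

lemma balanced_disjoint:
  assumes "set c \<inter> W = {}"
  shows "balanced W c"
proof -
  have "weight W s = int (length s)" if "sublist s c" for s
    using assms set_mono_sublist[OF that] by (intro weight_disjoint) auto
  then show ?thesis
    by (auto simp: balanced_def)
qed

lemma weight_prefix_concat_nonneg:
  assumes "\<forall>c\<in>set cs. balanced W c" and "prefix p (concat cs)"
  shows "0 \<le> weight W p"
  using assms
proof (induction cs arbitrary: p)
  case (Cons c cs)
  have c: "0 \<le> weight W c" "\<And>p. prefix p c \<Longrightarrow> 0 \<le> weight W p"
    using Cons.prems(1) by (auto simp: balanced_def)
  from Cons.prems(2) consider "prefix p c" | q where "p = c @ q" "prefix q (concat cs)"
    by (auto simp: prefix_append)
  then show ?case
    using c Cons by cases force+
qed simp

text \<open>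
  A segment that leaves a chunk starts with a nonempty suffix of that chunk, of positive weight,
  and continues with a prefix of a concatenation of chunks, which cannot make up for it.
\<close>

lemma nonpositive_segment_within_chunk:
  assumes "\<forall>c\<in>set cs. balanced W c" and "sublist s (concat cs)"
    and "s \<noteq> []" and "weight W s \<le> 0"
  shows "\<exists>c\<in>set cs. sublist s c"
  using assms
proof (induction cs)
  case (Cons c cs)
  from Cons.prems(2) consider "sublist s c" | "sublist s (concat cs)"
    | s1 s2 where "s = s1 @ s2" "suffix s1 c" "prefix s2 (concat cs)" "s1 \<noteq> []"
    by (auto simp: sublist_append) (metis append_Nil prefix_imp_sublist)
  then show ?case
  proof cases
    case 3
    have "0 < weight W s1"
      using 3 Cons.prems(1) by (auto simp: balanced_def)
    moreover have "0 \<le> weight W s2"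
      using 3 Cons.prems(1) by (intro weight_prefix_concat_nonneg[of cs]) auto
    ultimately show ?thesis
      using 3 Cons.prems(4) by simp
  qed (use Cons in auto)
qed simp

section \<open>Chunks\<close>

fun interleave :: "'a list \<Rightarrow> 'a list \<Rightarrow> 'a list" where
  "interleave (w # ws) (u # v # us) = u # v # w # interleave ws us"
| "interleave ws us = ws @ us"

lemma mset_interleave: "mset (interleave ws us) = mset ws + mset us"
  by (induction ws us rule: interleave.induct) auto

lemma balanced_Cons3:
  assumes c: "balanced W c" "weight W c = 3" and "u \<notin> W" "v \<notin> W" "w \<in> W"
  shows "balanced W (u # v # w # c)"
proof -
  have pre: "0 \<le> weight W p" if "prefix p c" for p
    using c that by (simp add: balanced_def)
  have suf: "0 < weight W s" if "suffix s c" "s \<noteq> []" for s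
    using c that by (simp add: balanced_def)
  have seg: "- 2 \<le> weight W s" if "sublist s c" for s
    using c that by (simp add: balanced_def)
  have "0 \<le> weight W p" if p: "prefix p (u # v # w # c)" for p
    using p pre assms(3-) by (auto simp: prefix_Cons)
  moreover have "0 < weight W s" if s: "suffix s (u # v # w # c)" "s \<noteq> []" for s
    using s suf assms(2-) by (auto simp: suffix_Cons)
  moreover have "- 2 \<le> weight W s" if s: "sublist s (u # v # w # c)" for s
  proof -
    have "sublist s c \<or> prefix s (w # c) \<or> prefix s (v # w # c) \<or> prefix s (u # v # w # c)"
      using s by (auto simp: sublist_Cons_right)
    then show ?thesis
      using seg assms(3-) by (auto simp: prefix_Cons dest!: pre)
  qed
  ultimately show ?thesis
    by (simp add: balanced_def)
qed

lemma balanced_interleave: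
  assumes "length us = 2 * length ws + 3" and "set ws \<subseteq> W" and "set us \<inter> W = {}"
  shows "balanced W (interleave ws us) \<and> weight W (interleave ws us) = 3"
  using assms
proof (induction ws us rule: interleave.induct)
  case (1 w ws u v us)
  then show ?case
    by (simp add: balanced_Cons3)
next
  case ("2_1" us)
  then show ?case
    using balanced_disjoint[of us W] weight_disjoint[of us W] by simp
qed auto

section \<open>Choosing the points outside the covered set\<close>

lemma block_simps:
  assumes "partial_steiner_triple_system V \<B>" and "b \<in> \<B>"
  shows "b \<subseteq> V" "finite b" "card b = 3"
  using assms by (auto simp: partial_steiner_triple_system_def intro: finite_subset)

lemma block_unique:
  assumes "partial_steiner_triple_system V \<B>"
    and "b \<in> \<B>" "c \<in> \<B>" "x \<noteq> y" "{x, y} \<subseteq> b" "{x, y} \<subseteq> c"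
  shows "b = c"
proof (rule ccontr)
  assume "b \<noteq> c"
  then have "card (b \<inter> c) \<le> 1" and "finite (b \<inter> c)"
    using assms block_simps[OF assms(1,2)] by (auto simp: partial_steiner_triple_system_def)
  moreover have "card {x, y} \<le> card (b \<inter> c)"
    using \<open>finite (b \<inter> c)\<close> assms by (intro card_mono) auto
  ultimately show False
    using \<open>x \<noteq> y\<close> by simp
qed

lemma card_third_points_le:
  assumes psts: "partial_steiner_triple_system V \<B>"
    and fin: "finite A" "finite B" and "A \<inter> B = {}"
  shows "finite {x. \<exists>w\<in>A. \<exists>u\<in>B. {w, u, x} \<in> \<B>}"
    and "card {x. \<exists>w\<in>A. \<exists>u\<in>B. {w, u, x} \<in> \<B>} \<le> card A * card B"
proof -
  let ?F = "{x. \<exists>w\<in>A. \<exists>u\<in>B. {w, u, x} \<in> \<B>}"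
  have "?F \<subseteq> (\<lambda>(w, u). THE x. {w, u, x} \<in> \<B>) ` (A \<times> B)"
  proof
    fix x assume "x \<in> ?F"
    then obtain w u where wu: "w \<in> A" "u \<in> B" "{w, u, x} \<in> \<B>"
      by blast
    have "(THE x. {w, u, x} \<in> \<B>) = x"
    proof (rule the_equality)
      fix y assume y: "{w, u, y} \<in> \<B>"
      have "{w, u, y} = {w, u, x}"
        using wu y \<open>A \<inter> B = {}\<close> by (intro block_unique[OF psts, of _ _ w u]) auto
      moreover have "y \<notin> {w, u}"
        using block_simps(3)[OF psts y] by (auto simp: insert_commute card_insert_if split: if_splits)
      ultimately show "y = x"
        by blast
    qed (fact wu(3))
    then show "x \<in> (\<lambda>(w, u). THE x. {w, u, x} \<in> \<B>) ` (A \<times> B)"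
      using wu by force
  qed
  moreover have "finite (A \<times> B)"
    using fin by simp
  ultimately show "finite ?F" and "card ?F \<le> card A * card B"
    using surj_card_le[of "A \<times> B" ?F] finite_surj[of "A \<times> B" ?F]
    by (simp_all only: card_cartesian_product)
qed

text \<open>
  Points are added to \<open>B\<close> one at a time. Before the last addition \<open>B\<close> has \<open>i - 1\<close> points and
  excludes at most \<open>card A * (i - 1)\<close> others; the assumption on \<open>card U\<close> says, without
  subtraction, that together these are fewer than \<open>card U\<close>.
\<close>

lemma greedy_independent_set:
  assumes psts: "partial_steiner_triple_system V \<B>"
    and "finite A" "finite U" "A \<inter> U = {}"
    and "(card A + 1) * i < card U + card A + 1"
  shows "\<exists>B\<subseteq>U. card B = i \<and> (\<forall>w\<in>A. \<forall>u\<in>B. \<forall>x\<in>B. {w, u, x} \<notin> \<B>)"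
  using assms(5)
proof (induction i)
  case 0
  then show ?case
    by (intro exI[of _ "{}"]) auto
next
  case (Suc i)
  then obtain B where B: "B \<subseteq> U" "card B = i" "\<forall>w\<in>A. \<forall>u\<in>B. \<forall>x\<in>B. {w, u, x} \<notin> \<B>"
    by (auto simp: algebra_simps)
  have "finite B"
    using B(1) \<open>finite U\<close> by (rule finite_subset)
  let ?F = "{x. \<exists>w\<in>A. \<exists>u\<in>B. {w, u, x} \<in> \<B>}"
  have F: "finite ?F" "card ?F \<le> card A * card B"
    using card_third_points_le[OF psts \<open>finite A\<close> \<open>finite B\<close>] B(1) \<open>A \<inter> U = {}\<close> by auto
  have "card (B \<union> ?F) < card U"
    using card_Un_le[of B ?F] F(2) B(2) Suc.prems by (simp add: algebra_simps)
  then obtain x where x: "x \<in> U" "x \<notin> B" "x \<notin> ?F"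
    using F(1) \<open>finite B\<close> card_mono[of "B \<union> ?F" U] by (meson UnCI finite_UnI leD subsetI)
  have "{w, x, x} \<notin> \<B>" for w
    using block_simps(3)[OF psts, of "{w, x, x}"] by (auto simp: card_insert_if split: if_splits)
  moreover have "{w, u, x} \<notin> \<B>" "{w, x, u} \<notin> \<B>" if "w \<in> A" "u \<in> B" for w u
    using that x(3) by (auto simp: insert_commute)
  ultimately have "\<forall>w\<in>A. \<forall>u\<in>insert x B. \<forall>y\<in>insert x B. {w, u, y} \<notin> \<B>"
    using B(3) by blast
  then show ?case
    using x B \<open>finite B\<close> by (intro exI[of _ "insert x B"]) auto
qed

definition good_chunk :: "'a set set \<Rightarrow> 'a set \<Rightarrow> 'a list \<Rightarrow> bool" where
  "good_chunk \<B> W c \<longleftrightarrow> balanced W c \<and> (\<forall>b\<in>\<B>. b \<subseteq> set c \<longrightarrow> card (b \<inter> W) \<noteq> 1)"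

lemma block_with_one_point:
  assumes "card b = 3" and "card (b \<inter> W) = 1"
  obtains w u x where "b = {w, u, x}" "w \<in> W" "u \<notin> W" "x \<notin> W"
proof -
  obtain w where w: "b \<inter> W = {w}"
    using assms(2) by (auto simp: card_1_singleton_iff)
  then have "card (b - {w}) = 2"
    using assms(1) by (subst card_Diff_singleton) auto
  then obtain u x where "b - {w} = {u, x}"
    by (auto simp: card_2_iff)
  then show thesis
    using w by (intro that[of w u x]) auto
qed

lemma exists_good_chunk:
  assumes psts: "partial_steiner_triple_system V \<B>"
    and ws: "distinct ws" "set ws \<subseteq> W"
    and U: "finite U" "U \<inter> W = {}" "2 * (length ws + 1)\<^sup>2 < card U"
  shows "\<exists>c B. good_chunk \<B> W c \<and> distinct c \<and> set c = set ws \<union> B \<and> B \<subseteq> U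
           \<and> card B = 2 * length ws + 3"
proof -
  have "set ws \<inter> U = {}"
    using ws(2) U(2) by blast
  have "(card (set ws) + 1) * (2 * length ws + 3) < card U + card (set ws) + 1"
    using U(3) ws(1) by (simp add: distinct_card power2_eq_square algebra_simps)
  then obtain B where B: "B \<subseteq> U" "card B = 2 * length ws + 3"
      "\<forall>w\<in>set ws. \<forall>u\<in>B. \<forall>x\<in>B. {w, u, x} \<notin> \<B>"
    using greedy_independent_set[OF psts, of "set ws" U "2 * length ws + 3"] U(1) \<open>set ws \<inter> U = {}\<close>
    by blast
  obtain us where us: "set us = B" "distinct us"
    using B(1) U(1) finite_distinct_list finite_subset by metis
  define c where "c = interleave ws us"
  have c: "mset c = mset (ws @ us)"
    by (simp add: c_def mset_interleave)
  have set_c: "set c = set ws \<union> B"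
    using mset_eq_setD[OF c] us by simp
  have "distinct c"
    using mset_eq_imp_distinct_iff[OF c] us ws B(1) U(2) by auto
  have "length us = 2 * length ws + 3"
    using us B(2) distinct_card by metis
  then have "balanced W c"
    using balanced_interleave[of us ws W] us ws B(1) U(2) by (auto simp: c_def)
  moreover have "card (b \<inter> W) \<noteq> 1" if b: "b \<in> \<B>" "b \<subseteq> set c" for b
  proof
    assume one: "card (b \<inter> W) = 1"
    have "card b = 3"
      using psts b(1) by (rule block_simps)
    then obtain w u x where "b = {w, u, x}" "w \<in> W" "u \<notin> W" "x \<notin> W"
      using one by (rule block_with_one_point)
    moreover have "w \<in> set ws" "u \<in> B" "x \<in> B"
      using calculation b(2) B(1) U(2) ws(2) set_c by auto
    ultimately show False
      using b(1) B(3) by blast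
  qed
  ultimately have "good_chunk \<B> W c"
    by (simp add: good_chunk_def)
  then show ?thesis
    using B(1,2) \<open>distinct c\<close> set_c by blast
qed

text \<open>
  The bound on \<open>card U\<close> is an invariant of the construction: a chunk with \<open>j\<close> points of \<open>W\<close> uses
  up \<open>2j + 3\<close> points of \<open>U\<close>, and the final summand is the reserve needed for the next greedy
  choice. After \<open>q\<close> chunks all the remaining points of \<open>U\<close> form a last chunk.
\<close>

lemma exists_good_chunks:
  assumes psts: "partial_steiner_triple_system V \<B>"
    and meet: "\<forall>b\<in>\<B>. b \<inter> W \<noteq> {}"
    and "distinct ws" "set ws \<subseteq> W" "length ws \<le> m * q"
    and "finite U" "U \<inter> W = {}" "2 * length ws + 3 * q + 2 * (m + 1)\<^sup>2 < card U"
  shows "\<exists>cs. (\<forall>c\<in>set cs. good_chunk \<B> W c) \<and> distinct (concat cs)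
           \<and> set (concat cs) = set ws \<union> U"
  using assms(3-)
proof (induction q arbitrary: ws U)
  case 0
  obtain us where us: "set us = U" "distinct us"
    using \<open>finite U\<close> finite_distinct_list by blast
  have "card (b \<inter> W) \<noteq> 1" if "b \<in> \<B>" "b \<subseteq> U" for b
    using meet that \<open>U \<inter> W = {}\<close> by blast
  then have "good_chunk \<B> W us"
    using us 0 by (auto simp: good_chunk_def balanced_disjoint)
  then show ?case
    using us 0 by (intro exI[of _ "[us]"]) auto
next
  case (Suc q)
  define a d where "a = take m ws" and "d = drop m ws"
  have ad: "ws = a @ d"
    by (simp add: a_def d_def)
  have len_a: "length a \<le> m" and len_d: "length d \<le> m * q"
    using Suc.prems(3) by (auto simp: a_def d_def)
  have "2 * (length a + 1)\<^sup>2 \<le> 2 * (m + 1)\<^sup>2"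
    using len_a by (intro mult_left_mono power_mono) auto
  then have "2 * (length a + 1)\<^sup>2 < card U"
    using Suc.prems(6) by linarith
  then obtain c B where c: "good_chunk \<B> W c" "distinct c" "set c = set a \<union> B" "B \<subseteq> U"
      "card B = 2 * length a + 3"
    using exists_good_chunk[OF psts, of a W U] Suc.prems ad by auto
  have "finite B"
    using c(4) Suc.prems(4) by (rule finite_subset)
  then have "card (U - B) = card U - (2 * length a + 3)"
    using c(4,5) by (simp add: card_Diff_subset)
  then have "2 * length d + 3 * q + 2 * (m + 1)\<^sup>2 < card (U - B)"
    using Suc.prems(6) ad by simp
  then obtain cs where cs: "\<forall>c\<in>set cs. good_chunk \<B> W c" "distinct (concat cs)"
      "set (concat cs) = set d \<union> (U - B)"
    using Suc.IH[of d "U - B"] Suc.prems ad len_d by auto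
  have "set c \<inter> set (concat cs) = {}"
    using c(3,4) cs(3) ad Suc.prems(1,2,5) by auto
  then have "distinct (concat (c # cs))"
    using c(2) cs(2) by simp
  moreover have "set (concat (c # cs)) = set ws \<union> U"
    using c(3,4) cs(3) ad by auto
  ultimately show ?case
    using c(1) cs(1) by (intro exI[of _ "c # cs"]) auto
qed

section \<open>Sequenceability\<close>

lemma card_Union_Int_disjoint:
  assumes "finite D" and "\<forall>b\<in>D. finite b" and "pairwise disjnt D"
  shows "card (\<Union>D \<inter> W) = (\<Sum>b\<in>D. card (b \<inter> W))"
proof -
  have "\<Union>D \<inter> W = (\<Union>b\<in>D. b \<inter> W)"
    by blast
  moreover have "card (\<Union>b\<in>D. b \<inter> W) = (\<Sum>b\<in>D. card (b \<inter> W))"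
    using assms by (intro card_UN_disjoint) (auto simp: pairwise_def disjnt_def)
  ultimately show ?thesis
    by simp
qed

text \<open>
  If a segment of length \<open>3r\<close> is a union of \<open>r\<close> disjoint blocks, all of which meet \<open>W\<close>, then its
  weight is at most \<open>0\<close>, so it lies in one chunk. Were all of these blocks to have at least two
  points in \<open>W\<close>, the weight would be at most \<open>-3r\<close>, less than a chunk allows. So one of them has
  exactly one point in \<open>W\<close>, which a good chunk excludes.
\<close>

lemma sequenceable_of_good_chunks:
  assumes psts: "partial_steiner_triple_system V \<B>"
    and meet: "\<forall>b\<in>\<B>. b \<inter> W \<noteq> {}"
    and good: "\<forall>c\<in>set cs. good_chunk \<B> W c"
    and seq: "sequencing V (concat cs)"
  shows "sequenceable V \<B>"
proof -
  have False
    if s: "r \<ge> 1" "sublist s (concat cs)" "length s = 3 * r" "disjoint_blocks \<B> r D"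
      "set s = \<Union>D" for r s D
  proof -
    have D: "D \<subseteq> \<B>" "card D = r" "pairwise disjnt D" "finite D"
      using s(1,4) by (auto simp: disjoint_blocks_def intro: card_ge_0_finite)
    have fin: "finite b" if "b \<in> D" for b
      using that D(1) block_simps(2)[OF psts] by blast
    have "distinct s"
      using seq s(2) by (auto simp: sequencing_def sublist_def)
    then have weight_s: "weight W s = 3 * int r - 3 * int (\<Sum>b\<in>D. card (b \<inter> W))"
      using card_Union_Int_disjoint[OF D(4) _ D(3)] fin s(3,5) by (simp add: weight_distinct)
    have pos: "card (b \<inter> W) \<ge> 1" if "b \<in> D" for b
      using meet that D(1) fin[OF that] by (auto simp: Suc_le_eq card_gt_0_iff)
    have "r \<le> (\<Sum>b\<in>D. card (b \<inter> W))"
      using sum_mono[of D "\<lambda>_. 1" "\<lambda>b. card (b \<inter> W)"] pos D(2) by simp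
    then have "weight W s \<le> 0"
      using weight_s by linarith
    moreover have "s \<noteq> []"
      using s(1,3) by auto
    ultimately obtain c where c: "c \<in> set cs" "sublist s c"
      using nonpositive_segment_within_chunk[of cs W s] good s(2) by (auto simp: good_chunk_def)
    have "\<exists>b\<in>D. card (b \<inter> W) < 2"
    proof (rule ccontr)
      assume "\<not> ?thesis"
      then have "2 * r \<le> (\<Sum>b\<in>D. card (b \<inter> W))"
        using sum_mono[of D "\<lambda>_. 2" "\<lambda>b. card (b \<inter> W)"] D(2) by (simp add: not_less)
      then have "weight W s \<le> - 3"
        using weight_s s(1) by linarith
      moreover have "- 2 \<le> weight W s"
        using c good by (auto simp: good_chunk_def balanced_def)
      ultimately show False
        by simp
    qed
    then obtain b where b: "b \<in> D" "card (b \<inter> W) = 1"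
      using pos by force
    have "b \<subseteq> set c"
      using b(1) s(5) set_mono_sublist[OF c(2)] by blast
    then show False
      using good c(1) b D(1) by (auto simp: good_chunk_def)
  qed
  then show ?thesis
    using seq unfolding sequenceable_def by blast
qed

lemma block_meets_maximum_family:
  assumes psts: "partial_steiner_triple_system V \<B>"
    and M: "disjoint_blocks \<B> k M"
    and max: "\<not> (\<exists>D. disjoint_blocks \<B> (k + 1) D)"
    and b: "b \<in> \<B>"
  shows "b \<inter> \<Union>M \<noteq> {}"
proof
  assume disj: "b \<inter> \<Union>M = {}"
  have "\<B> \<subseteq> Pow V" and "finite V" and "card b = 3"
    using psts b by (auto simp: partial_steiner_triple_system_def)
  then have "finite M"
    using M by (auto simp: disjoint_blocks_def intro: finite_subset[of M "Pow V"])
  moreover have "b \<notin> M"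
    using disj \<open>card b = 3\<close> by (metis Int_absorb2 Sup_upper card.empty zero_neq_numeral)
  moreover have "pairwise disjnt (insert b M)"
    using M disj by (auto simp: disjoint_blocks_def pairwise_insert disjnt_def)
  ultimately have "disjoint_blocks \<B> (k + 1) (insert b M)"
    using M b by (auto simp: disjoint_blocks_def)
  then show False
    using max by blast
qed

text \<open>
  Writing \<open>t\<close> for the cube root of \<open>k\<close>, take \<open>m\<close> and \<open>q\<close> to be \<open>t\<close> and \<open>3t\<^sup>2\<close> rounded up. Then
  \<open>m q \<ge> 3 t\<^sup>3 = 3k\<close>, while the cost is at most \<open>9t\<^sup>2 + 3 + 2 (t + 2)\<^sup>2\<close>. This is at most
  \<open>22t\<^sup>2 + 10\<close> once \<open>t \<ge> 1\<close>, which fails only for \<open>k = 0\<close>.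
\<close>

lemma exists_chunk_parameters:
  fixes k :: nat
  shows "\<exists>m q. 3 * k \<le> m * q
           \<and> real (3 * q + 2 * (m + 1)\<^sup>2) \<le> 22 * real k powr (2 / 3) + 10"
proof (cases "k = 0")
  case True
  then show ?thesis
    by (intro exI[of _ 0]) simp
next
  case False
  define t where "t = real k powr (1 / 3)"
  have t: "t \<ge> 1"
    using False by (simp add: t_def ge_one_powr_ge_zero)
  have t2: "real k powr (2 / 3) = t\<^sup>2" and t3: "real k = t ^ 3"
    using False by (simp_all add: t_def powr_powr flip: powr_numeral)
  define m q where "m = nat \<lceil>t\<rceil>" and "q = nat \<lceil>3 * t\<^sup>2\<rceil>"
  have m: "t \<le> real m" "real m \<le> t + 1"
    using t by (auto simp: m_def real_nat_ceiling_ge of_nat_nat)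
  have q: "3 * t\<^sup>2 \<le> real q" "real q \<le> 3 * t\<^sup>2 + 1"
    by (auto simp: q_def real_nat_ceiling_ge of_nat_nat)
  have "real (3 * k) = t * (3 * t\<^sup>2)"
    by (simp add: t3 power2_eq_square power3_eq_cube)
  also have "\<dots> \<le> real (m * q)"
    using m q t by (simp add: mult_mono)
  finally have "3 * k \<le> m * q"
    by linarith
  have "(real m + 1)\<^sup>2 \<le> (t + 2)\<^sup>2"
    using m t by (intro power_mono) auto
  then have "real (3 * q + 2 * (m + 1)\<^sup>2) \<le> 3 * (3 * t\<^sup>2 + 1) + 2 * (t + 2)\<^sup>2"
    using q by (simp add: add.commute)
  also have "\<dots> = 11 * t\<^sup>2 + 8 * t + 11"
    by (simp add: power2_eq_square algebra_simps)
  also have "\<dots> \<le> 22 * t\<^sup>2 + 10"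
    using t self_le_power[of t 2] by simp
  finally show ?thesis
    using \<open>3 * k \<le> m * q\<close> t2 by auto
qed

theorem theorem19:
  fixes V :: "'a set" and \<B> :: "'a set set" and n k :: nat
  assumes "partial_steiner_triple_system V \<B>"
    and "card V = n"
    and "\<exists>D. disjoint_blocks \<B> k D"
    and "\<not> (\<exists>D. disjoint_blocks \<B> (k + 1) D)"
    and "real n > 9 * real k + 22 * real k powr (2 / 3) + 10"
  shows "sequenceable V \<B>"
proof -
  obtain M where M: "disjoint_blocks \<B> k M"
    using assms(3) by blast
  define W where "W = \<Union>M"
  have meet: "\<forall>b\<in>\<B>. b \<inter> W \<noteq> {}"
    using block_meets_maximum_family[OF assms(1) M assms(4)] by (simp add: W_def)
  have "finite V" and "W \<subseteq> V"
    using assms(1) M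
    by (auto simp: partial_steiner_triple_system_def disjoint_blocks_def W_def)
  then have "finite W"
    using finite_subset by blast
  have "card W = (\<Sum>b\<in>M. card b)"
    using M assms(1) unfolding W_def
    by (intro card_Union_disjoint)
      (auto simp: disjoint_blocks_def partial_steiner_triple_system_def intro: finite_subset)
  also have "\<dots> = (\<Sum>b\<in>M. 3)"
    using M assms(1)
    by (intro sum.cong) (auto simp: disjoint_blocks_def partial_steiner_triple_system_def)
  finally have card_W: "card W = 3 * k"
    using M by (simp add: disjoint_blocks_def)
  then have card_U: "card (V - W) = n - 3 * k" and "3 * k \<le> n"
    using \<open>W \<subseteq> V\<close> \<open>finite V\<close> \<open>finite W\<close> assms(2) card_mono[of V W]
    by (auto simp: card_Diff_subset)
  obtain ws where ws: "set ws = W" "distinct ws"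
    using \<open>finite W\<close> finite_distinct_list by blast
  then have len: "length ws = 3 * k"
    using card_W distinct_card by metis
  obtain m q where mq: "3 * k \<le> m * q"
      "real (3 * q + 2 * (m + 1)\<^sup>2) \<le> 22 * real k powr (2 / 3) + 10"
    using exists_chunk_parameters by blast
  have "real (9 * k + (3 * q + 2 * (m + 1)\<^sup>2)) < real n"
    using mq(2) assms(5) by simp
  then have "2 * length ws + 3 * q + 2 * (m + 1)\<^sup>2 < card (V - W)"
    using len card_U \<open>3 * k \<le> n\<close> by linarith
  then obtain cs where cs: "\<forall>c\<in>set cs. good_chunk \<B> W c" "distinct (concat cs)"
      "set (concat cs) = set ws \<union> (V - W)"
    using exists_good_chunks[OF assms(1) meet, of ws m q "V - W"] ws len mq(1) \<open>finite V\<close>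
    by auto
  then have "sequencing V (concat cs)"
    using ws \<open>W \<subseteq> V\<close> by (auto simp: sequencing_def)
  then show ?thesis
    using sequenceable_of_good_chunks[OF assms(1) meet cs(1)] by blast
qed

end
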